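(* Let $(\Gamma^{\text{can}}_0,Q)$ represent a left-truncated one-dimensional exponential family such that $\beta_{\sup}=0$ and $Q$ admits a density $q$ either with respect to Lebesgue measure on $\mathbb{R}$ or with respect to counting measure on $\mathbb{Z}$. If $q(x)=O(1/x^{1+\alpha})$ as $x\to\infty$ for some $\alpha>0$, then for every $\beta\in\Gamma^{\text{can}}_0$ the Jeffreys integral $$\int_\beta^0 I(\gamma)^{1/2}\,d\gamma$$ is finite.
   Context: Exponential family. $Q$ is a nonzero $\sigma$-finite measure on $\mathbb{R}$, $Z(\beta)=\int e^{\beta x}\,dQ(x)$, $\Gamma^{\text{can}}=\{\beta\in\mathbb{R}: Z(\beta)<\infty\}$ (an interval), $\beta_{\sup}=\sup\Gamma^{\text{can}}$ and $\beta_{\inf}=\inf\Gamma^{\text{can}}$. For $\beta\in\Gamma^{\text{can}}$, $P_\beta$ is the probability measure with $\frac{dP_\beta}{dQ}(x)=\frac{1}{Z(\beta)}e^{\beta x}$. Left-truncated family. The pair $(\Gamma^{\text{can}}_0,Q)$ denotes the family $\{P_\beta:\beta\in\Gamma^{\text{can}}_0\}$, where $\Gamma^{\text{can}}_0=\{\beta\in\Gamma^{\text{can}}:\beta\ge b\}$ for some fixed $b$ with $\beta_{\inf}<b<\beta_{\sup}$. Fisher information. $I(\gamma)$ is the Fisher information at $\gamma$ in the canonical parametrization, i.e. the variance of $P_\gamma$. *)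

theory Defs
  imports "HOL-Probability.Probability" "HOL-Library.Landau_Symbols"
begin

definition partition_fn :: "real measure \<Rightarrow> real \<Rightarrow> ennreal" where
  "partition_fn Q \<beta> = (\<integral>\<^sup>+x. ennreal (exp (\<beta> * x)) \<partial>Q)"

definition can_space :: "real measure \<Rightarrow> real set" where
  "can_space Q = {\<beta>. partition_fn Q \<beta> < \<infinity>}"

definition beta_sup :: "real measure \<Rightarrow> ereal" where
  "beta_sup Q = Sup (ereal ` can_space Q)"

definition beta_inf :: "real measure \<Rightarrow> ereal" where
  "beta_inf Q = Inf (ereal ` can_space Q)"

definition exp_family :: "real measure \<Rightarrow> real \<Rightarrow> real measure" where
  "exp_family Q \<beta> = density Q (\<lambda>x. 1 / partition_fn Q \<beta> * ennreal (exp (\<beta> * x)))"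

definition left_trunc_space :: "real measure \<Rightarrow> real \<Rightarrow> real set" where
  "left_trunc_space Q b = {\<beta> \<in> can_space Q. b \<le> \<beta>}"

text \<open>The variance is taken as an extended nonnegative number, so that an infinite variance
  is \<open>\<infinity>\<close> and not the default value 0 of the Bochner integral. If the mean of \<open>M\<close> does not exist,
  the Bochner integral in the centering is 0, and the value is \<open>\<infinity>\<close> as well.\<close>

definition evariance :: "real measure \<Rightarrow> ennreal" where
  "evariance M = (\<integral>\<^sup>+x. ennreal ((x - (\<integral>y. y \<partial>M))\<^sup>2) \<partial>M)"

definition fisher_info :: "real measure \<Rightarrow> real \<Rightarrow> ennreal" where
  "fisher_info Q \<gamma> = evariance (exp_family Q \<gamma>)"

definition ennreal_sqrt :: "ennreal \<Rightarrow> ennreal" where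
  "ennreal_sqrt x = (if x = \<infinity> then \<infinity> else ennreal (sqrt (enn2real x)))"

definition jeffreys_integral :: "real measure \<Rightarrow> real \<Rightarrow> real \<Rightarrow> ennreal" where
  "jeffreys_integral Q a c = (\<integral>\<^sup>+\<gamma>\<in>{a..c}. ennreal_sqrt (fisher_info Q \<gamma>) \<partial>lborel)"

text \<open>Counting measure on the integers, as a Borel measure on the reals.\<close>

definition counting_ints :: "real measure" where
  "counting_ints = distr (count_space (UNIV :: int set)) borel real_of_int"

lemma evariance_eq_variance:
  assumes "prob_space M" and "integrable M (\<lambda>x. x)" and "integrable M (\<lambda>x. x\<^sup>2)"
  shows "evariance M = ennreal (prob_space.variance M (\<lambda>x. x))"
proof -
  interpret prob_space M by fact
  have "integrable M (\<lambda>x. (x - (\<integral>y. y \<partial>M))\<^sup>2)"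
    using assms(2,3) by (simp add: power2_diff)
  then show ?thesis
    unfolding evariance_def by (intro nn_integral_eq_integral) auto
qed

lemma prob_space_exp_family:
  assumes "sets Q = sets borel" and "emeasure Q (space Q) \<noteq> 0" and "\<beta> \<in> can_space Q"
  shows "prob_space (exp_family Q \<beta>)"
proof
  note [measurable_cong] = assms(1)
  have fin: "partition_fn Q \<beta> \<noteq> \<infinity>"
    using assms(3) by (auto simp: can_space_def)
  have "partition_fn Q \<beta> \<noteq> 0"
  proof
    assume "partition_fn Q \<beta> = 0"
    then have "AE x in Q. ennreal (exp (\<beta> * x)) = 0"
      unfolding partition_fn_def by (subst (asm) nn_integral_0_iff_AE) auto
    then have "AE x in Q. False" by eventually_elim (simp add: ennreal_eq_0_iff not_le)
    then show False
      using assms(2) by (simp add: AE_iff_null null_sets_def)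
  qed
  then have "partition_fn Q \<beta> / partition_fn Q \<beta> = 1"
    using fin by (simp add: ennreal_divide_self less_top)
  then show "emeasure (exp_family Q \<beta>) (space (exp_family Q \<beta>)) = 1"
    unfolding exp_family_def
    by (subst emeasure_density)
       (auto simp: ennreal_divide_times nn_integral_divide partition_fn_def[of Q \<beta>, symmetric]
             cong: nn_integral_cong)
qed

end

theory Submission
  imports Defs
begin

text \<open>The tail bound makes some moment \<open>\<integral>\<^sub>x\<^sub>\<ge>\<^sub>0 x\<^sup>\<delta> dQ\<close> with \<open>0 < \<delta> < 2\<close> finite. Since
  \<open>x\<^bsup>2-\<delta>\<^esup> e\<^bsup>-tx\<^esup>\<close> is at most a constant times \<open>t\<^bsup>-(2-\<delta>)\<^esup>\<close>, and the partition function is bounded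
  away from 0 on \<open>[b, 0]\<close>, the second moment of \<open>P\<^sub>\<gamma>\<close>, hence \<open>I(\<gamma>)\<close>, is \<open>O(\<bar>\<gamma>\<bar>\<^bsup>-(2-\<delta>)\<^esup>)\<close>. Its square root is
  \<open>O(\<bar>\<gamma>\<bar>\<^bsup>\<delta>/2-1\<^esup>)\<close>, which is integrable at 0.\<close>

section \<open>Elementary bounds for powers, variances and the exponential family\<close>

text \<open>Raise y \<le> e^y, at y = tx/s, to the power s. The exact maximum over x carries a
  further factor e^(-s), which is dropped.\<close>

lemma powr_times_exp_le:
  fixes s t x :: real
  assumes "s > 0" "t > 0" "x \<ge> 0"
  shows "x powr s * exp (- t * x) \<le> (s / t) powr s"
proof -
  have "t * x / s \<le> exp (t * x / s)"
    using exp_ge_add_one_self[of "t * x / s"] by linarith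
  then have "(t * x / s) powr s \<le> exp (t * x / s) powr s"
    using assms by (intro powr_mono2) auto
  also have "\<dots> = exp (t * x)"
    using assms by (simp add: exp_powr_real)
  finally have "(s / t) powr s * (t * x / s) powr s \<le> (s / t) powr s * exp (t * x)"
    by (intro mult_left_mono) auto
  also have "(s / t) powr s * (t * x / s) powr s = x powr s"
    using assms by (subst powr_mult[symmetric]) auto
  finally show ?thesis
    by (simp add: exp_minus field_simps)
qed

text \<open>If the second moment is infinite, there is nothing to show. Otherwise the mean exists as
  well, \<open>evariance\<close> is the usual variance, and centering subtracts the square of the
  mean.\<close>

lemma evariance_le_second_moment:
  assumes "prob_space M" and M [measurable_cong]: "sets M = sets borel"
  shows "evariance M \<le> (\<integral>\<^sup>+x. ennreal (x\<^sup>2) \<partial>M)"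
proof (cases "(\<integral>\<^sup>+x. ennreal (x\<^sup>2) \<partial>M) = \<infinity>")
  case False
  interpret prob_space M by fact
  have int2: "integrable M (\<lambda>x. x\<^sup>2)"
    using False by (intro integrableI_nonneg) (auto simp: less_top)
  then have int1: "integrable M (\<lambda>x. x)"
    by (rule square_integrable_imp_integrable[rotated]) simp
  have "evariance M = ennreal (variance (\<lambda>x. x))"
    by (rule evariance_eq_variance) fact+
  also have "\<dots> \<le> ennreal (expectation (\<lambda>x. x\<^sup>2))"
    by (intro ennreal_leI) (simp add: variance_eq[OF int1 int2])
  also have "\<dots> = (\<integral>\<^sup>+x. ennreal (x\<^sup>2) \<partial>M)"
    using int2 by (subst nn_integral_eq_integral) auto
  finally show ?thesis .
qed simp

text \<open>The function e^(wx) lies below e^(vx) for x \<ge> 0 and below e^(ux) for x < 0, hence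
  everywhere below their sum.\<close>

lemma can_space_convex:
  assumes [measurable_cong]: "sets Q = sets borel"
    and "u \<in> can_space Q" "v \<in> can_space Q" "u \<le> w" "w \<le> v"
  shows "w \<in> can_space Q"
proof -
  have "exp (w * x) \<le> exp (u * x) + exp (v * x)" for x
  proof (cases "x \<ge> 0")
    case True
    then have "exp (w * x) \<le> exp (v * x)" using assms by (simp add: mult_right_mono)
    then show ?thesis by (simp add: add_increasing)
  next
    case False
    then have "exp (w * x) \<le> exp (u * x)" using assms by (simp add: mult_right_mono_neg)
    then show ?thesis by (simp add: add_increasing2)
  qed
  then have "partition_fn Q w \<le> (\<integral>\<^sup>+x. ennreal (exp (u * x)) + ennreal (exp (v * x)) \<partial>Q)"
    unfolding partition_fn_def by (intro nn_integral_mono) (simp flip: ennreal_plus)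
  also have "\<dots> = partition_fn Q u + partition_fn Q v"
    unfolding partition_fn_def by (rule nn_integral_add) auto
  finally show ?thesis
    using assms by (auto simp: can_space_def intro: order_le_less_trans)
qed

text \<open>Only an upper bound on the variance is wanted, so the centering, which depends on
  \<gamma>, is dropped; what remains are two integrals over \<open>Q\<close> that can be estimated
  separately.\<close>

lemma fisher_info_le:
  assumes Q [measurable_cong]: "sets Q = sets borel" and "emeasure Q (space Q) \<noteq> 0"
    and "\<gamma> \<in> can_space Q"
  shows "fisher_info Q \<gamma> \<le> (\<integral>\<^sup>+x. ennreal (x\<^sup>2 * exp (\<gamma> * x)) \<partial>Q) / partition_fn Q \<gamma>"
proof -
  have "fisher_info Q \<gamma> \<le> (\<integral>\<^sup>+x. ennreal (x\<^sup>2) \<partial>exp_family Q \<gamma>)"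
    unfolding fisher_info_def
    by (intro evariance_le_second_moment prob_space_exp_family assms)
       (simp add: exp_family_def Q)
  also have "\<dots> = (\<integral>\<^sup>+x. ennreal (x\<^sup>2 * exp (\<gamma> * x)) / partition_fn Q \<gamma> \<partial>Q)"
    unfolding exp_family_def
    by (subst nn_integral_density)
       (auto intro!: nn_integral_cong simp: ennreal_mult divide_ennreal_def ac_simps)
  also have "\<dots> = (\<integral>\<^sup>+x. ennreal (x\<^sup>2 * exp (\<gamma> * x)) \<partial>Q) / partition_fn Q \<gamma>"
    by (subst nn_integral_divide) auto
  finally show ?thesis .
qed

section \<open>Uniform estimates for parameters between b and 0\<close>

text \<open>For all these \<gamma> the integrand e^(\<gamma>x) has the common minorant min(1,
  e^(bx)). This is positive everywhere, so its integral over the nonzero measure \<open>Q\<close> is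
  positive.\<close>

lemma partition_fn_bounded_below:
  assumes Q [measurable_cong]: "sets Q = sets borel" and nz: "emeasure Q (space Q) \<noteq> 0"
  obtains z :: real where "z > 0" "\<And>\<gamma>. b \<le> \<gamma> \<Longrightarrow> \<gamma> \<le> 0 \<Longrightarrow> ennreal z \<le> partition_fn Q \<gamma>"
proof -
  define Z where "Z = (\<integral>\<^sup>+x. ennreal (min 1 (exp (b * x))) \<partial>Q)"
  have "Z \<noteq> 0"
  proof
    assume "Z = 0"
    then have "AE x in Q. ennreal (min 1 (exp (b * x))) = 0"
      unfolding Z_def by (subst (asm) nn_integral_0_iff_AE) auto
    then have "AE x in Q. False"
      by eventually_elim (simp add: ennreal_eq_0_iff not_le min_def split: if_splits)
    then show False
      using nz by (simp add: AE_iff_null null_sets_def)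
  qed
  have Z_le: "Z \<le> partition_fn Q \<gamma>" if "b \<le> \<gamma>" "\<gamma> \<le> 0" for \<gamma>
    unfolding Z_def partition_fn_def
  proof (intro nn_integral_mono ennreal_leI)
    fix x :: real
    show "min 1 (exp (b * x)) \<le> exp (\<gamma> * x)"
    proof (cases "x \<ge> 0")
      case True
      then have "exp (b * x) \<le> exp (\<gamma> * x)" using that by (simp add: mult_right_mono)
      then show ?thesis by (rule min.coboundedI2)
    next
      case False
      then have "1 \<le> exp (\<gamma> * x)" using that by (simp add: mult_nonpos_nonpos)
      then show ?thesis by (rule min.coboundedI1)
    qed
  qed
  show thesis
  \<comment> \<open>Nothing assumed here makes \<open>Z\<close> finite; the cap at 1 yields a real
    bound.\<close>
  proof (rule that[of "enn2real (min 1 Z)"])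
    have fin: "min 1 Z < \<infinity>" by (auto simp: min_less_iff_disj)
    have pos: "min 1 Z > 0" using \<open>Z \<noteq> 0\<close> by (auto simp: zero_less_iff_neq_zero)
    show "enn2real (min 1 Z) > 0"
      using fin pos by (simp add: enn2real_positive_iff)
    show "ennreal (enn2real (min 1 Z)) \<le> partition_fn Q \<gamma>" if "b \<le> \<gamma>" "\<gamma> \<le> 0" for \<gamma>
      using fin Z_le[OF that] by (simp add: min.coboundedI2)
  qed
qed

text \<open>The negative half-line contributes a bounded amount, since \<open>b\<close> is interior to the canonical
  parameter space; on the positive half-line \<open>x\<^sup>2 e\<^bsup>\<gamma>x\<^esup> = (x\<^bsup>2-\<delta>\<^esup> e\<^bsup>\<gamma>x\<^esup>) x\<^sup>\<delta>\<close>.\<close>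

lemma second_moment_le:
  assumes Q [measurable_cong]: "sets Q = sets borel"
    and b': "b' \<in> can_space Q" "b' < b"
    and \<delta>: "\<delta> < 2"
    and moment: "(\<integral>\<^sup>+x\<in>{0..}. ennreal (x powr \<delta>) \<partial>Q) < \<infinity>"
  obtains A :: real where "A \<ge> 0"
    "\<And>\<gamma>. b \<le> \<gamma> \<Longrightarrow> \<gamma> < 0 \<Longrightarrow>
      (\<integral>\<^sup>+x. ennreal (x\<^sup>2 * exp (\<gamma> * x)) \<partial>Q) \<le> ennreal (A * (- \<gamma>) powr - (2 - \<delta>))"
proof -
  define s where "s = 2 - \<delta>"
  have s: "s > 0" using \<delta> by (simp add: s_def)
  obtain M where M: "M \<ge> 0" "(\<integral>\<^sup>+x\<in>{0..}. ennreal (x powr \<delta>) \<partial>Q) = ennreal M"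
    using moment by (cases "\<integral>\<^sup>+x\<in>{0..}. ennreal (x powr \<delta>) \<partial>Q") auto
  obtain W where W: "W \<ge> 0" "partition_fn Q b' = ennreal W"
    using b' by (cases "partition_fn Q b'") (auto simp: can_space_def)
  \<comment> \<open>This is the bound of \<open>powr_times_exp_le\<close> for exponent 2 and rate b
    - b'. On the negative half-line, e^(\<gamma>x) is e^(b'x) times a factor that decays at least at
    this rate for every \<gamma> \<ge> b.\<close>
  define K where "K = (2 / (b - b')) powr 2"
  \<comment> \<open>The first summand comes from the negative half-line: its contribution K W is
    turned into a multiple of (-\<gamma>)^(-s) by means of -\<gamma> \<le> -b. The second comes from
    the positive half-line.\<close>
  define A where "A = K * W * (- b) powr s + s powr s * M"
  have K: "K \<ge> 0" by (simp add: K_def)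
  show thesis
  proof (rule that[of A])
    show "A \<ge> 0" using K W M by (simp add: A_def)
    fix \<gamma> :: real assume \<gamma>: "b \<le> \<gamma>" "\<gamma> < 0"
    define L where "L = (s / - \<gamma>) powr s"
    have L: "L \<ge> 0" by (simp add: L_def)
    have "ennreal (x\<^sup>2 * exp (\<gamma> * x)) \<le>
        ennreal K * ennreal (exp (b' * x)) + ennreal L * (ennreal (x powr \<delta>) * indicator {0..} x)" for x
    proof (cases "x \<ge> 0")
      case True
      have "x\<^sup>2 * exp (\<gamma> * x) = (x powr s * exp (- (- \<gamma>) * x)) * x powr \<delta>"
        \<comment> \<open>The factor \<open>x powr \<delta>\<close> cancels only for nonzero x; at 0
          both sides vanish because \<open>0 powr s = 0\<close>.\<close>
        using True by (cases "x = 0") (auto simp: s_def powr_diff)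
      also have "\<dots> \<le> L * x powr \<delta>"
        unfolding L_def using powr_times_exp_le[OF s, of "- \<gamma>" x] \<gamma> True
        by (intro mult_right_mono) auto
      finally have "ennreal (x\<^sup>2 * exp (\<gamma> * x)) \<le> ennreal L * ennreal (x powr \<delta>)"
        using L by (simp flip: ennreal_mult)
      then show ?thesis using True by (simp add: add_increasing)
    next
      case False
      have "x\<^sup>2 * exp (\<gamma> * x) = (- x) powr 2 * exp ((\<gamma> - b') * x) * exp (b' * x)"
        using False by (simp add: algebra_simps flip: exp_add)
      also have "\<dots> \<le> (- x) powr 2 * exp (- (b - b') * - x) * exp (b' * x)"
        using mult_right_mono_neg[of b \<gamma> x] False \<gamma>
        by (intro mult_right_mono mult_left_mono) (auto simp: algebra_simps)
      also have "\<dots> \<le> K * exp (b' * x)"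
        unfolding K_def using powr_times_exp_le[of 2 "b - b'" "- x"] b' False
        by (intro mult_right_mono) auto
      finally show ?thesis
        using False K by (simp flip: ennreal_mult)
    qed
    then have "(\<integral>\<^sup>+x. ennreal (x\<^sup>2 * exp (\<gamma> * x)) \<partial>Q) \<le>
      (\<integral>\<^sup>+x. ennreal K * ennreal (exp (b' * x)) +
        ennreal L * (ennreal (x powr \<delta>) * indicator {0..} x) \<partial>Q)"
      by (intro nn_integral_mono)
    also have "\<dots> = ennreal K * partition_fn Q b' +
        ennreal L * (\<integral>\<^sup>+x\<in>{0..}. ennreal (x powr \<delta>) \<partial>Q)"
      unfolding partition_fn_def
      by (subst nn_integral_add) (auto simp: nn_integral_cmult)
    also have "\<dots> = ennreal (K * W + L * M)"
      using K L W M by (simp add: ennreal_mult)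
    also have "K * W + L * M \<le> A * (- \<gamma>) powr - s"
    proof -
      have "(- \<gamma>) powr s \<le> (- b) powr s"
        using \<gamma> s by (intro powr_mono2) auto
      then have "1 \<le> (- b) powr s * (- \<gamma>) powr - s"
        using \<gamma> by (simp add: powr_minus field_simps)
      then have "K * W * 1 \<le> K * W * ((- b) powr s * (- \<gamma>) powr - s)"
        using K W by (intro mult_left_mono) auto
      moreover have "L = s powr s * (- \<gamma>) powr - s"
        using powr_divide[of s "- \<gamma>" s] s \<gamma> by (simp add: L_def powr_minus_divide)
      ultimately show ?thesis by (simp add: A_def algebra_simps)
    qed
    finally show "(\<integral>\<^sup>+x. ennreal (x\<^sup>2 * exp (\<gamma> * x)) \<partial>Q) \<le>
        ennreal (A * (- \<gamma>) powr - (2 - \<delta>))"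
      by (simp add: s_def ennreal_leI)
  qed
qed

section \<open>Integrability of the square root of the Fisher information\<close>

lemma ennreal_sqrt_le:
  assumes "x \<le> ennreal y" "y \<ge> 0"
  shows "ennreal_sqrt x \<le> ennreal (sqrt y)"
proof -
  have "x \<noteq> \<infinity>" using assms by (auto simp: top_unique)
  then show ?thesis
    using assms by (cases x) (auto simp: ennreal_sqrt_def intro!: ennreal_leI)
qed

text \<open>Reflection at 0 reduces this to the integral of x^a over [0, -c].\<close>

lemma nn_integral_powr_minus_to_0:
  fixes a c :: real
  assumes "a > -1" "c \<le> 0"
  shows "(\<integral>\<^sup>+\<gamma>\<in>{c..0}. ennreal ((- \<gamma>) powr a) \<partial>lborel) < \<infinity>"
proof -
  have "((\<lambda>x. (- x) powr a) has_integral ((- c) powr (a + 1) / (a + 1))) {c..0}"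
    using has_integral_powr_from_0[of a "- c"] assms
      has_integral_reflect_real[of "\<lambda>x. x powr a" "(- c) powr (a + 1) / (a + 1)" "- c" 0]
    by simp
  then show ?thesis
    by (subst nn_integral_has_integral_lebesgue') auto
qed

text \<open>This separates the analysis near 0 from the tail condition: the density of
  \<open>Q\<close> will enter only through the finite moment of order \<delta>.\<close>

lemma jeffreys_integral_finite_if_moment:
  assumes Q: "sets Q = sets borel" and nz: "emeasure Q (space Q) \<noteq> 0"
    and b: "beta_inf Q < ereal b" and sup: "beta_sup Q = 0"
    and \<delta>: "0 < \<delta>" "\<delta> < 2"
    and moment: "(\<integral>\<^sup>+x\<in>{0..}. ennreal (x powr \<delta>) \<partial>Q) < \<infinity>"
    and \<beta>: "\<beta> \<in> left_trunc_space Q b"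
  shows "jeffreys_integral Q \<beta> 0 < \<infinity>"
proof -
  obtain b' where b': "b' \<in> can_space Q" "b' < b"
    using b by (auto simp: beta_inf_def Inf_less_iff)
  have "ereal \<beta> \<le> beta_sup Q"
    unfolding beta_sup_def using \<beta> by (intro Sup_upper) (auto simp: left_trunc_space_def)
  then have \<beta>_bounds: "b \<le> \<beta>" "\<beta> \<le> 0"
    using \<beta> sup by (auto simp: left_trunc_space_def zero_ereal_def)
  \<comment> \<open>The supremum 0 need not be attained, so only \<gamma> < 0 is claimed: such a
    \<gamma> lies between b' and some v in the parameter space.\<close>
  have can: "\<gamma> \<in> can_space Q" if "b \<le> \<gamma>" "\<gamma> < 0" for \<gamma>
  proof -
    have "ereal \<gamma> < Sup (ereal ` can_space Q)"
      using that sup by (simp add: beta_sup_def zero_ereal_def)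
    then obtain v where "v \<in> can_space Q" "\<gamma> < v"
      by (auto simp: less_Sup_iff)
    then show ?thesis using can_space_convex[OF Q b'(1)] that b' by auto
  qed
  obtain z where z: "z > 0" "\<And>\<gamma>. b \<le> \<gamma> \<Longrightarrow> \<gamma> \<le> 0 \<Longrightarrow> ennreal z \<le> partition_fn Q \<gamma>"
    using partition_fn_bounded_below[OF Q nz] by blast
  obtain A where A: "A \<ge> 0" "\<And>\<gamma>. b \<le> \<gamma> \<Longrightarrow> \<gamma> < 0 \<Longrightarrow>
      (\<integral>\<^sup>+x. ennreal (x\<^sup>2 * exp (\<gamma> * x)) \<partial>Q) \<le> ennreal (A * (- \<gamma>) powr - (2 - \<delta>))"
    using second_moment_le[OF Q b' \<delta>(2) moment] by blast
  have bound: "ennreal_sqrt (fisher_info Q \<gamma>) \<le>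
      ennreal (sqrt (A / z)) * ennreal ((- \<gamma>) powr (\<delta> / 2 - 1))"
    if \<gamma>: "b \<le> \<gamma>" "\<gamma> < 0" for \<gamma>
  proof -
    have "fisher_info Q \<gamma> \<le> (\<integral>\<^sup>+x. ennreal (x\<^sup>2 * exp (\<gamma> * x)) \<partial>Q) / partition_fn Q \<gamma>"
      by (rule fisher_info_le[OF Q nz can[OF \<gamma>]])
    also have "\<dots> \<le> ennreal (A * (- \<gamma>) powr - (2 - \<delta>)) / partition_fn Q \<gamma>"
      by (rule divide_right_mono_ennreal[OF A(2)[OF \<gamma>]])
    also have "\<dots> \<le> ennreal (A / z * (- \<gamma>) powr - (2 - \<delta>))"
    proof -
      \<comment> \<open>Finiteness of the partition function at \<gamma> turns the quotient in
        \<open>ennreal\<close> into one of real numbers.\<close>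
      obtain w where w: "w \<ge> 0" "partition_fn Q \<gamma> = ennreal w"
        using can[OF \<gamma>] by (cases "partition_fn Q \<gamma>") (auto simp: can_space_def)
      then have "z \<le> w" using z(2)[of \<gamma>] \<gamma> by simp
      then have "A * (- \<gamma>) powr - (2 - \<delta>) / w \<le> A * (- \<gamma>) powr - (2 - \<delta>) / z"
        using A z by (intro divide_left_mono) auto
      then show ?thesis
        using A z w \<open>z \<le> w\<close> by (simp add: divide_ennreal ennreal_leI)
    qed
    finally have "ennreal_sqrt (fisher_info Q \<gamma>) \<le> ennreal (sqrt (A / z * (- \<gamma>) powr - (2 - \<delta>)))"
      using A z by (intro ennreal_sqrt_le) auto
    also have "sqrt (A / z * (- \<gamma>) powr - (2 - \<delta>)) = sqrt (A / z) * (- \<gamma>) powr (\<delta> / 2 - 1)"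
    proof -
      have "(- \<gamma>) powr - (2 - \<delta>) = ((- \<gamma>) powr (\<delta> / 2 - 1))\<^sup>2"
        by (simp add: power2_eq_square flip: powr_add)
      then show ?thesis
        by (simp only: real_sqrt_mult real_sqrt_abs) simp
    qed
    finally show ?thesis
      using A z by (simp add: ennreal_mult)
  qed
  have "jeffreys_integral Q \<beta> 0 \<le>
      (\<integral>\<^sup>+\<gamma>. ennreal (sqrt (A / z)) * (ennreal ((- \<gamma>) powr (\<delta> / 2 - 1)) * indicator {\<beta>..0} \<gamma>) \<partial>lborel)"
    unfolding jeffreys_integral_def
  proof (rule nn_integral_mono_AE)
    \<comment> \<open>The point \<gamma> = 0 has to be excluded: the Fisher information may be
      infinite there, while \<open>0 powr (\<delta> / 2 - 1)\<close> is 0.\<close>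
    show "AE \<gamma> in lborel. ennreal_sqrt (fisher_info Q \<gamma>) * indicator {\<beta>..0} \<gamma> \<le>
        ennreal (sqrt (A / z)) * (ennreal ((- \<gamma>) powr (\<delta> / 2 - 1)) * indicator {\<beta>..0} \<gamma>)"
      using AE_lborel_singleton[of 0]
    proof eventually_elim
      case (elim \<gamma>)
      then show ?case
        using bound[of \<gamma>] \<beta>_bounds by (auto simp: indicator_def)
    qed
  qed
  also have "\<dots> = ennreal (sqrt (A / z)) *
      (\<integral>\<^sup>+\<gamma>\<in>{\<beta>..0}. ennreal ((- \<gamma>) powr (\<delta> / 2 - 1)) \<partial>lborel)"
    by (rule nn_integral_cmult) auto
  also have "\<dots> < \<infinity>"
    using nn_integral_powr_minus_to_0[of "\<delta> / 2 - 1" \<beta>] \<delta> \<beta>_bounds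
    by (simp add: ennreal_mult_less_top)
  finally show ?thesis .
qed

section \<open>From the tail of the density to a finite moment\<close>

text \<open>On [0, N] the power x^\<delta> is at most a multiple of e^(cx), which is integrable
  against q; beyond N the tail bound gives q(x) x^\<delta> \<le> C x^(\<delta>-\<alpha>-1). A
  general \<mu> covers Lebesgue and counting measure at once, and the tail bound is required only
  almost everywhere because in the lattice case it is known only at integers.\<close>

lemma moment_finite_if_density_tail:
  fixes q :: "real \<Rightarrow> real"
  assumes \<mu> [measurable_cong]: "sets \<mu> = sets borel"
    and [measurable]: "q \<in> borel_measurable borel" and "\<And>x. 0 \<le> q x"
    and \<delta>: "0 \<le> \<delta>" and c: "c \<in> can_space (density \<mu> (\<lambda>x. ennreal (q x)))"
    and C: "C \<ge> 0" and N: "N \<ge> 1"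
    and tail: "AE x in \<mu>. x \<ge> N \<longrightarrow> q x \<le> C * (1 / x powr (1 + \<alpha>))"
    and fin: "(\<integral>\<^sup>+x\<in>{1..}. ennreal (x powr (\<delta> - \<alpha> - 1)) \<partial>\<mu>) < \<infinity>"
  shows "(\<integral>\<^sup>+x\<in>{0..}. ennreal (x powr \<delta>) \<partial>density \<mu> (\<lambda>x. ennreal (q x))) < \<infinity>"
proof -
  \<comment> \<open>On [0, N], x^\<delta> \<le> N^\<delta> and e^(cx) \<ge> e^(-|c|N), whatever the
    sign of c.\<close>
  define K where "K = N powr \<delta> * exp (\<bar>c\<bar> * N)"
  have K: "K \<ge> 0" by (simp add: K_def)
  have small: "x powr \<delta> \<le> K * exp (c * x)" if "0 \<le> x" "x \<le> N" for x
  proof -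
    have "\<bar>c\<bar> * x \<le> \<bar>c\<bar> * N" using that by (intro mult_left_mono) auto
    moreover have "- (c * x) \<le> \<bar>c\<bar> * x"
      using that by (metis abs_ge_minus_self abs_mult abs_of_nonneg)
    ultimately have "1 \<le> exp (\<bar>c\<bar> * N) * exp (c * x)"
      by (simp flip: exp_add)
    moreover have "x powr \<delta> \<le> N powr \<delta>" using that \<delta> by (intro powr_mono2) auto
    ultimately have "x powr \<delta> * 1 \<le> N powr \<delta> * (exp (\<bar>c\<bar> * N) * exp (c * x))"
      by (intro mult_mono) auto
    then show ?thesis by (simp add: K_def mult.assoc)
  qed
  have "(\<integral>\<^sup>+x\<in>{0..}. ennreal (x powr \<delta>) \<partial>density \<mu> (\<lambda>x. ennreal (q x))) =
      (\<integral>\<^sup>+x. ennreal (q x) * (ennreal (x powr \<delta>) * indicator {0..} x) \<partial>\<mu>)"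
    by (rule nn_integral_density) auto
  also have "\<dots> \<le> (\<integral>\<^sup>+x. ennreal K * (ennreal (q x) * ennreal (exp (c * x))) +
      ennreal C * (ennreal (x powr (\<delta> - \<alpha> - 1)) * indicator {1..} x) \<partial>\<mu>)"
  proof (rule nn_integral_mono_AE)
    show "AE x in \<mu>. ennreal (q x) * (ennreal (x powr \<delta>) * indicator {0..} x) \<le>
        ennreal K * (ennreal (q x) * ennreal (exp (c * x))) +
        ennreal C * (ennreal (x powr (\<delta> - \<alpha> - 1)) * indicator {1..} x)"
      using tail
    proof eventually_elim
      case (elim x)
      consider "x < 0" | "0 \<le> x" "x \<le> N" | "x > N" by linarith
      then show ?case
      proof cases
        case 1
        then show ?thesis by simp
      next
        case 2
        have "q x * x powr \<delta> \<le> q x * (K * exp (c * x))"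
          using small[OF 2] assms(3) by (intro mult_left_mono) auto
        then have "ennreal (q x) * ennreal (x powr \<delta>) \<le>
            ennreal K * (ennreal (q x) * ennreal (exp (c * x)))"
          using assms(3) K by (simp add: mult.left_commute flip: ennreal_mult)
        then show ?thesis using 2 by (simp add: add_increasing2)
      next
        \<comment> \<open>Here N \<ge> 1 places x in \<open>{1..}\<close>, the range of integration
          in \<open>fin\<close>.\<close>
        case 3
        have "q x * x powr \<delta> \<le> C * (1 / x powr (1 + \<alpha>)) * x powr \<delta>"
          using elim 3 by (intro mult_right_mono) auto
        also have "\<dots> = C * x powr (\<delta> - \<alpha> - 1)"
          using 3 N by (simp add: powr_diff powr_add)
        finally have "ennreal (q x) * ennreal (x powr \<delta>) \<le>
            ennreal C * ennreal (x powr (\<delta> - \<alpha> - 1))"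
          using assms(3) C by (simp flip: ennreal_mult)
        then show ?thesis using 3 N by (simp add: add_increasing)
      qed
    qed
  qed
  also have "\<dots> = ennreal K * partition_fn (density \<mu> (\<lambda>x. ennreal (q x))) c +
      ennreal C * (\<integral>\<^sup>+x\<in>{1..}. ennreal (x powr (\<delta> - \<alpha> - 1)) \<partial>\<mu>)"
    unfolding partition_fn_def
    by (subst nn_integral_add) (auto simp: nn_integral_cmult nn_integral_density)
  also have "\<dots> < \<infinity>"
    using c fin by (simp add: can_space_def ennreal_mult_less_top)
  finally show ?thesis .
qed

lemma nn_integral_powr_tail_lborel:
  fixes e :: real
  assumes "e < -1"
  shows "(\<integral>\<^sup>+x\<in>{1..}. ennreal (x powr e) \<partial>lborel) < \<infinity>"
  using has_integral_powr_to_inf[of e 1] assms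
  by (subst nn_integral_has_integral_lebesgue') auto

text \<open>Pulled back to the integers and reindexed by natural numbers, the integral becomes the
  convergent series of n^e.\<close>

lemma nn_integral_powr_tail_counting_ints:
  fixes e :: real
  assumes "e < -1"
  shows "(\<integral>\<^sup>+x\<in>{1..}. ennreal (x powr e) \<partial>counting_ints) < \<infinity>"
proof -
  have "(\<integral>\<^sup>+x\<in>{1..}. ennreal (x powr e) \<partial>counting_ints) =
      (\<integral>\<^sup>+n. ennreal (real_of_int n powr e) * indicator {1..} (real_of_int n) \<partial>count_space UNIV)"
    unfolding counting_ints_def by (rule nn_integral_distr) auto
  also have "\<dots> = (\<integral>\<^sup>+n. ennreal (real_of_int n powr e) * indicator {1..} n \<partial>count_space UNIV)"
    by (intro nn_integral_cong) (auto simp: indicator_def)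
  also have "\<dots> = (\<integral>\<^sup>+n. ennreal (real_of_int n powr e) \<partial>count_space {1..})"
    by (simp add: nn_integral_count_space_indicator)
  also have "\<dots> = (\<integral>\<^sup>+n. ennreal (real_of_int (int n) powr e) \<partial>count_space {1..})"
    by (rule nn_integral_bij_count_space[symmetric], rule bij_betw_byWitness[where f' = nat]) auto
  \<comment> \<open>The index 0 is added; its term is \<open>0 powr e = 0\<close>.\<close>
  also have "\<dots> \<le> (\<integral>\<^sup>+n. ennreal (real n powr e) \<partial>count_space UNIV)"
    by (simp add: nn_integral_count_space_indicator nn_integral_mono indicator_def)
  also have "\<dots> = (\<Sum>n. ennreal (real n powr e))"
    by (rule nn_integral_count_space_nat)
  also have "\<dots> < \<infinity>"
    using assms by (simp add: suminf_ennreal2 summable_real_powr_iff)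
  finally show ?thesis .
qed

theorem theorem3:
  fixes Q :: "real measure" and q :: "real \<Rightarrow> real" and b \<alpha> :: real
  assumes "sets Q = sets borel" and "sigma_finite_measure Q" and "emeasure Q (space Q) \<noteq> 0"
    and "beta_inf Q < ereal b" and "ereal b < beta_sup Q"
    and "beta_sup Q = 0"
    and "q \<in> borel_measurable borel" and "\<And>x. 0 \<le> q x"
    and "\<alpha> > 0"
    and "(Q = density lborel (\<lambda>x. ennreal (q x)) \<and>
            q \<in> O[at_top](\<lambda>x. 1 / x powr (1 + \<alpha>))) \<or>
         (Q = density counting_ints (\<lambda>x. ennreal (q x)) \<and>
            (\<lambda>n::int. q (real_of_int n)) \<in> O[at_top](\<lambda>n. 1 / real_of_int n powr (1 + \<alpha>)))"
  shows "\<forall>\<beta>\<in>left_trunc_space Q b. jeffreys_integral Q \<beta> 0 < \<infinity>"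
proof
  fix \<beta> assume \<beta>: "\<beta> \<in> left_trunc_space Q b"
  then have can: "\<beta> \<in> can_space Q" by (simp add: left_trunc_space_def)
  \<comment> \<open>Staying below \<alpha> makes the exponent \<delta> - \<alpha> - 1 less than -1,
    so the tail converges; the cap at 1 keeps \<delta> below 2 for large \<alpha>.\<close>
  define \<delta> where "\<delta> = min \<alpha> 1 / 2"
  have \<delta>: "0 < \<delta>" "\<delta> < 2" "\<delta> - \<alpha> - 1 < -1"
    using \<open>\<alpha> > 0\<close> by (auto simp: \<delta>_def min_def)
  have "(\<integral>\<^sup>+x\<in>{0..}. ennreal (x powr \<delta>) \<partial>Q) < \<infinity>"
    using assms(10)
  proof (elim disjE conjE)
    assume Q: "Q = density lborel (\<lambda>x. ennreal (q x))"
      and "q \<in> O[at_top](\<lambda>x. 1 / x powr (1 + \<alpha>))"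
    then obtain C where C: "C > 0"
        "eventually (\<lambda>x. norm (q x) \<le> C * norm (1 / x powr (1 + \<alpha>))) at_top"
      by (auto elim: landau_o.bigE)
    then obtain N where N: "\<And>x. x \<ge> N \<Longrightarrow> q x \<le> C * (1 / x powr (1 + \<alpha>))"
      using assms(8) by (auto simp: eventually_at_top_linorder)
    \<comment> \<open>The parameter \<beta> itself supplies the exponential moment that controls
      bounded x, and \<open>max 1 N\<close> secures a threshold of at least 1.\<close>
    show ?thesis
      unfolding Q
      using can assms(7,8) \<delta> C(1) N nn_integral_powr_tail_lborel[OF \<delta>(3)]
      by (intro moment_finite_if_density_tail[where c = \<beta> and C = C and N = "max 1 N" and \<alpha> = \<alpha>])
         (auto simp: Q)
  next
    assume Q: "Q = density counting_ints (\<lambda>x. ennreal (q x))"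
      and "(\<lambda>n::int. q (real_of_int n)) \<in> O[at_top](\<lambda>n. 1 / real_of_int n powr (1 + \<alpha>))"
    then obtain C where C: "C > 0" "eventually (\<lambda>n::int. norm (q (real_of_int n)) \<le>
        C * norm (1 / real_of_int n powr (1 + \<alpha>))) at_top"
      by (auto elim: landau_o.bigE)
    then obtain N :: int where
        N: "\<And>n. n \<ge> N \<Longrightarrow> q (real_of_int n) \<le> C * (1 / real_of_int n powr (1 + \<alpha>))"
      using assms(8) by (auto simp: eventually_at_top_linorder)
    \<comment> \<open>An almost-everywhere statement for this image measure is a statement about
      every integer, which is what the bound along integers provides.\<close>
    have "AE x in counting_ints. x \<ge> real_of_int (max 1 N) \<longrightarrow> q x \<le> C * (1 / x powr (1 + \<alpha>))"
      unfolding counting_ints_def using assms(7) N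
      by (subst AE_distr_iff) (auto simp: AE_count_space)
    then show ?thesis
      unfolding Q
      using can assms(7,8) \<delta> C(1) nn_integral_powr_tail_counting_ints[OF \<delta>(3)]
      by (intro moment_finite_if_density_tail[where c = \<beta> and C = C and
            N = "real_of_int (max 1 N)" and \<alpha> = \<alpha>])
         (auto simp: Q counting_ints_def)
  qed
  then show "jeffreys_integral Q \<beta> 0 < \<infinity>"
    using assms \<delta> \<beta> by (intro jeffreys_integral_finite_if_moment[where \<delta> = \<delta> and b = b]) auto
qed

end
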